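(* Let $(a_0(n))_n$ and $(a_1(n))_n$ be real sequences with $2a_0(n)+a_1(n)=1$ for all $n$, and let $B_n^{M,1}$ be the associated modified Bernstein operators. Then for every $f\in C[0,1]$, every $x\in[0,1]$ and every integer $n\ge 1$, $$|B_n^{M,1}(f;x)-f(x)|\le |B_n(f;x)-f(x)|+\left|(1+a_1(n))\left(\tfrac12-x\right)\right|\,\omega_1\!\left(f;\tfrac1n\right).$$
   Context: Bernstein basis: $p_{n,k}(x)=\binom nk x^k(1-x)^{n-k}$ for $0\le k\le n$, $x\in[0,1]$ (with $0^0=1$), and $p_{n,k}=0$ if $k<0$ or $k>n$. Classical Bernstein operator: $B_n(f;x)=\sum_{k=0}^n p_{n,k}(x)f(k/n)$. Modified basis: given real sequences $a_0(n),a_1(n)$, put $a(x,n)=a_1(n)x+a_0(n)$ and, for $0\le k\le n$, $$p_{n,k}^{M,1}(x)=a(x,n)\,p_{n-1,k}(x)+a(1-x,n)\,p_{n-1,k-1}(x).$$ Modified Bernstein operator: $B_n^{M,1}(f;x)=\sum_{k=0}^n p_{n,k}^{M,1}(x)f(k/n)$. (No positivity of $B_n^{M,1}$ is assumed.) Modulus of continuity: $\omega_1(f;\delta)=\sup\{|f(s)-f(t)|: s,t\in[0,1],\ |s-t|\le\delta\}$. *)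

theory Defs
  imports "HOL-Analysis.Analysis"
begin

text \<open>The index ranges over the integers, so that \<open>p_{n-1,k-1}\<close> makes sense at \<open>k = 0\<close>.\<close>

definition bern_basis :: "nat \<Rightarrow> int \<Rightarrow> real \<Rightarrow> real" where
  "bern_basis n k x = (if 0 \<le> k \<and> k \<le> int n then Bernstein n (nat k) x else 0)"

definition bern_op :: "nat \<Rightarrow> (real \<Rightarrow> real) \<Rightarrow> real \<Rightarrow> real" where
  "bern_op n f x = (\<Sum>k=0..n. bern_basis n (int k) x * f (real k / real n))"

definition mod_coeff :: "(nat \<Rightarrow> real) \<Rightarrow> (nat \<Rightarrow> real) \<Rightarrow> real \<Rightarrow> nat \<Rightarrow> real" where
  "mod_coeff a0 a1 x n = a1 n * x + a0 n"

text \<open>Meaningful only for \<open>n \<ge> 1\<close>, because \<open>n - 1\<close> is truncated subtraction.\<close>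

definition mod_bern_basis ::
    "(nat \<Rightarrow> real) \<Rightarrow> (nat \<Rightarrow> real) \<Rightarrow> nat \<Rightarrow> nat \<Rightarrow> real \<Rightarrow> real" where
  "mod_bern_basis a0 a1 n k x =
     mod_coeff a0 a1 x n * bern_basis (n - 1) (int k) x
     + mod_coeff a0 a1 (1 - x) n * bern_basis (n - 1) (int k - 1) x"

definition mod_bern_op ::
    "(nat \<Rightarrow> real) \<Rightarrow> (nat \<Rightarrow> real) \<Rightarrow> nat \<Rightarrow> (real \<Rightarrow> real) \<Rightarrow> real \<Rightarrow> real" where
  "mod_bern_op a0 a1 n f x = (\<Sum>k=0..n. mod_bern_basis a0 a1 n k x * f (real k / real n))"

text \<open>The supremum is a real one: it is the intended value when \<open>f\<close> is bounded on
  \<open>[0,1]\<close> (in particular, continuous there) and \<open>\<delta> \<ge> 0\<close>.\<close>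

definition modulus_cont :: "(real \<Rightarrow> real) \<Rightarrow> real \<Rightarrow> real" where
  "modulus_cont f \<delta> =
     Sup {\<bar>f s - f t\<bar> | s t. s \<in> {0..1} \<and> t \<in> {0..1} \<and> \<bar>s - t\<bar> \<le> \<delta>}"

end

theory Submission
  imports Defs
begin

text \<open>The classical basis obeys the de Casteljau recurrence, which is the modified one with
  weights \<open>1 - x\<close> and \<open>x\<close> in place of \<open>a(x,n)\<close> and \<open>a(1-x,n)\<close>. Under \<open>2 a\<^sub>0 + a\<^sub>1 = 1\<close> the two pairs of
  weights differ by \<open>\<mp>(1 + a\<^sub>1)(1/2 - x)\<close>, so the two operators differ by this factor
  times an average, with weights \<open>p\<^bsub>n-1,k\<^esub>(x)\<close>, of the increments \<open>f((k+1)/n) - f(k/n)\<close>.\<close>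

lemma bern_basis_of_nat:
  "bern_basis n (int k) x = (if k \<le> n then Bernstein n k x else 0)"
  by (simp add: bern_basis_def)

text \<open>Pascal's rule in the interior; at \<open>k = 0\<close> and \<open>k = Suc m\<close> one
  term on the right is zero by the convention on indices out of range.\<close>

lemma bern_basis_Suc:
  "bern_basis (Suc m) (int k) x = (1 - x) * bern_basis m (int k) x + x * bern_basis m (int k - 1) x"
proof (cases k)
  case 0
  then show ?thesis
    by (simp add: bern_basis_def Bernstein_def)
next
  case (Suc j)
  then have eq: "int k - 1 = int j"
    by simp
  consider "Suc j \<le> m" | "j = m" | "j > m"
    by linarith
  then show ?thesis
  proof cases
    case 1
    \<comment> \<open>Exposes the factor \<open>1 - x\<close> in the power with exponent
      \<open>m - j\<close>, which also occurs on the left.\<close>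
    then have "m - j = Suc (m - Suc j)"
      by simp
    with 1 show ?thesis
      unfolding eq unfolding bern_basis_of_nat Suc by (simp add: Bernstein_def algebra_simps)
  next
    case 2
    then show ?thesis
      unfolding eq unfolding bern_basis_of_nat Suc by (simp add: Bernstein_def)
  next
    case 3
    then show ?thesis
      unfolding eq unfolding bern_basis_of_nat Suc by simp
  qed
qed

lemma sum_bern_basis:
  "(\<Sum>k=0..Suc m. bern_basis m (int k) x * g k) = (\<Sum>k\<le>m. Bernstein m k x * g k)"
  by (simp add: bern_basis_of_nat atLeast0AtMost)

text \<open>The term at \<open>k = 0\<close> carries index -1 and vanishes, so reindexing moves the
  shift from the basis to \<open>g\<close>.\<close>

lemma sum_bern_basis_shift:
  "(\<Sum>k=0..Suc m. bern_basis m (int k - 1) x * g k) = (\<Sum>k\<le>m. Bernstein m k x * g (Suc k))"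
proof -
  have "bern_basis m (- 1) x = 0"
    by (simp add: bern_basis_def)
  then show ?thesis
    unfolding atLeast0AtMost sum.atMost_Suc_shift by (simp add: bern_basis_of_nat)
qed

text \<open>With \<open>a0\<close> eliminated, both differences of weights vanish at
  \<open>x = 1/2\<close> and are linear in \<open>x\<close> with slopes of opposite sign.\<close>

lemma mod_bern_basis_Suc_diff:
  assumes "2 * a0 (Suc m) + a1 (Suc m) = 1"
  shows "mod_bern_basis a0 a1 (Suc m) k x - bern_basis (Suc m) (int k) x
    = (1 + a1 (Suc m)) * (1/2 - x) * (bern_basis m (int k - 1) x - bern_basis m (int k) x)"
proof -
  have a0: "a0 (Suc m) = (1 - a1 (Suc m)) / 2"
    using assms by simp
  show ?thesis
    unfolding mod_bern_basis_def bern_basis_Suc mod_coeff_def a0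
    by (simp add: field_simps)
qed

lemma mod_bern_op_Suc_diff:
  assumes "2 * a0 (Suc m) + a1 (Suc m) = 1"
  shows "mod_bern_op a0 a1 (Suc m) f x - bern_op (Suc m) f x
    = (1 + a1 (Suc m)) * (1/2 - x) *
      (\<Sum>k\<le>m. Bernstein m k x * (f (real (Suc k) / real (Suc m)) - f (real k / real (Suc m))))"
    (is "_ = ?c * _")
proof -
  let ?g = "\<lambda>k. f (real k / real (Suc m))"
  have "mod_bern_op a0 a1 (Suc m) f x - bern_op (Suc m) f x
      = (\<Sum>k=0..Suc m. (mod_bern_basis a0 a1 (Suc m) k x - bern_basis (Suc m) (int k) x) * ?g k)"
    unfolding mod_bern_op_def bern_op_def sum_subtractf [symmetric] left_diff_distrib ..
  also have "\<dots> = ?c * ((\<Sum>k=0..Suc m. bern_basis m (int k - 1) x * ?g k)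
                      - (\<Sum>k=0..Suc m. bern_basis m (int k) x * ?g k))"
    unfolding mod_bern_basis_Suc_diff [of a0 m a1, OF assms] sum_subtractf [symmetric] sum_distrib_left
    by (intro sum.cong) (auto simp only: left_diff_distrib mult.assoc)
  \<comment> \<open>Summation by parts; the zero convention leaves no boundary terms.\<close>
  also have "\<dots> = ?c * (\<Sum>k\<le>m. Bernstein m k x * (?g (Suc k) - ?g k))"
    unfolding sum_bern_basis sum_bern_basis_shift by (simp only: right_diff_distrib sum_subtractf)
  finally show ?thesis .
qed

text \<open>Continuity on a compact interval bounds \<open>f\<close>, so the real \<open>Sup\<close>
  is a genuine upper bound.\<close>

lemma abs_diff_le_modulus_cont:
  assumes "continuous_on {0..1} f" "s \<in> {0..1}" "t \<in> {0..1}" "\<bar>s - t\<bar> \<le> \<delta>"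
  shows "\<bar>f s - f t\<bar> \<le> modulus_cont f \<delta>"
proof -
  have "bounded (f ` {0..1})"
    using assms(1) by (intro compact_imp_bounded compact_continuous_image) simp_all
  then obtain B where B: "\<And>x. x \<in> {0..1} \<Longrightarrow> \<bar>f x\<bar> \<le> B"
    unfolding bounded_iff by force
  have "bdd_above {\<bar>f s - f t\<bar> | s t. s \<in> {0..1} \<and> t \<in> {0..1} \<and> \<bar>s - t\<bar> \<le> \<delta>}"
  proof (rule bdd_aboveI)
    fix y
    assume "y \<in> {\<bar>f s - f t\<bar> | s t. s \<in> {0..1} \<and> t \<in> {0..1} \<and> \<bar>s - t\<bar> \<le> \<delta>}"
    then obtain s t where "y = \<bar>f s - f t\<bar>" "s \<in> {0..1}" "t \<in> {0..1}"
      by blast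
    then show "y \<le> 2 * B"
      using B [of s] B [of t] by linarith
  qed
  then show ?thesis
    unfolding modulus_cont_def using assms(2-4) by (intro cSup_upper) auto
qed

text \<open>On [0,1] the weights are nonnegative and sum to 1.\<close>

lemma abs_Bernstein_average_le:
  assumes "x \<in> {0..1}" "\<And>k. k \<le> m \<Longrightarrow> \<bar>d k\<bar> \<le> w"
  shows "\<bar>\<Sum>k\<le>m. Bernstein m k x * d k\<bar> \<le> w"
proof -
  have "\<bar>\<Sum>k\<le>m. Bernstein m k x * d k\<bar> \<le> (\<Sum>k\<le>m. Bernstein m k x * w)"
    using assms by (intro sum_abs [THEN order_trans] sum_mono)
      (auto simp: abs_mult Bernstein_nonneg intro!: mult_left_mono)
  also have "\<dots> = w"
    by (simp add: sum_distrib_right [symmetric])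
  finally show ?thesis .
qed

theorem theorem4p1:
  fixes a0 a1 :: "nat \<Rightarrow> real"
  assumes "\<And>n. n \<ge> 1 \<Longrightarrow> 2 * a0 n + a1 n = 1"
  shows "\<forall>f :: real \<Rightarrow> real. continuous_on {0..1} f \<longrightarrow>
           (\<forall>x\<in>{0..1}. \<forall>n\<ge>1.
              \<bar>mod_bern_op a0 a1 n f x - f x\<bar>
              \<le> \<bar>bern_op n f x - f x\<bar>
                + \<bar>(1 + a1 n) * (1 / 2 - x)\<bar> * modulus_cont f (1 / real n))"
proof (intro allI impI ballI)
  fix f :: "real \<Rightarrow> real" and x :: real and n :: nat
  assume f: "continuous_on {0..1} f" and x: "x \<in> {0..1}" and n: "1 \<le> n"
  from n obtain m where m: "n = Suc m"
    by (cases n) auto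
  let ?d = "\<lambda>k. f (real (Suc k) / real n) - f (real k / real n)"
  have "\<bar>?d k\<bar> \<le> modulus_cont f (1 / real n)" if "k \<le> m" for k
  proof (rule abs_diff_le_modulus_cont [OF f])
    show "\<bar>real (Suc k) / real n - real k / real n\<bar> \<le> 1 / real n"
      by (simp add: diff_divide_distrib [symmetric])
  \<comment> \<open>Both nodes lie in [0,1], as \<open>k \<le> m\<close> gives
    \<open>Suc k \<le> n\<close>.\<close>
  qed (use that m in auto)
  then have average: "\<bar>\<Sum>k\<le>m. Bernstein m k x * ?d k\<bar> \<le> modulus_cont f (1 / real n)"
    by (rule abs_Bernstein_average_le [OF x])
  have "mod_bern_op a0 a1 n f x - bern_op n f x
      = (1 + a1 n) * (1/2 - x) * (\<Sum>k\<le>m. Bernstein m k x * ?d k)"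
    unfolding m using assms by (intro mod_bern_op_Suc_diff) simp
  then have "\<bar>mod_bern_op a0 a1 n f x - bern_op n f x\<bar>
      \<le> \<bar>(1 + a1 n) * (1/2 - x)\<bar> * modulus_cont f (1 / real n)"
    by (simp only: abs_mult [of "(1 + a1 n) * (1/2 - x)"] mult_left_mono [OF average abs_ge_zero])
  then show "\<bar>mod_bern_op a0 a1 n f x - f x\<bar>
      \<le> \<bar>bern_op n f x - f x\<bar> + \<bar>(1 + a1 n) * (1 / 2 - x)\<bar> * modulus_cont f (1 / real n)"
    \<comment> \<open>Triangle inequality through \<open>bern_op n f x\<close>.\<close>
    by linarith
qed

end
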